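(* Let $\alpha>1$, let $\alpha'$ be defined by $\frac1\alpha+\frac1{\alpha'}=1$, and set $p(r)=\frac{|r|^{\alpha}}{\alpha}$ and $p^*(\eta)=\frac{|\eta|^{\alpha'}}{\alpha'}$ for $r,\eta\in\mathbb{R}$. Let $\tau>0$. Then for each $\lambda>1$ there exist constants $C(\lambda,\tau),D(\tau,\lambda),C_1(\lambda,\tau),D_1(\tau,\lambda)>0$, depending on $\lambda$ and $\tau$, such that $$D(\tau,\lambda)\exp\left(2\tau p^*(\eta/\lambda)\right)\le\int_{\mathbb{R}}\exp\left(2\tau(r\eta-p(r))\right)dr\le C(\lambda,\tau)\exp\left(2\tau p^*(\lambda\eta)\right)$$ for each $\eta\in\mathbb{R}$, and $$D_1(\tau,\lambda)\exp\left(2\tau p(r/\lambda)\right)\le\int_{\mathbb{R}}\exp\left(2\tau(r\eta-p^*(\eta))\right)d\eta\le C_1(\lambda,\tau)\exp\left(2\tau p(\lambda r)\right)$$ for each $r\in\mathbb{R}$.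
   Context: The function $p^*$ is the Young conjugate of $p$: $p^*(\eta)=\sup_{x\ge0}\left[x|\eta|-p(x)\right]$. *)

theory Defs
  imports "HOL-Analysis.Analysis"
begin

(* Real-valued, hence meaningful only when the supremum is finite. *)
definition young_conjugate :: "(real \<Rightarrow> real) \<Rightarrow> real \<Rightarrow> real" where
  "young_conjugate p \<eta> = (SUP x\<in>{0..}. x * \<bar>\<eta>\<bar> - p x)"

(* The closed form used for the conjugate in the theorem; the supremum is attained. *)
lemma young_conjugate_power:
  fixes \<alpha> \<alpha>' \<eta> :: real
  assumes "\<alpha> > 1" and conj: "1 / \<alpha> + 1 / \<alpha>' = 1"
  shows "young_conjugate (\<lambda>r. \<bar>r\<bar> powr \<alpha> / \<alpha>) \<eta> = \<bar>\<eta>\<bar> powr \<alpha>' / \<alpha>'"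
proof -
  have "1 / \<alpha>' = 1 - 1 / \<alpha>" using conj by simp
  moreover have "0 < 1 - 1 / \<alpha>" "1 - 1 / \<alpha> < 1" using assms(1) by (auto simp: field_simps)
  ultimately have "0 < 1 / \<alpha>'" "1 / \<alpha>' < 1" by auto
  hence "\<alpha>' > 1" by (simp add: divide_less_eq split: if_splits)
  have prod: "\<alpha> * (\<alpha>' - 1) = \<alpha>'"
    using conj \<open>\<alpha> > 1\<close> \<open>\<alpha>' > 1\<close> by (simp add: field_simps)
  define y where "y = \<bar>\<eta>\<bar> powr (\<alpha>' - 1)"
  have y1: "y * \<bar>\<eta>\<bar> = \<bar>\<eta>\<bar> powr \<alpha>'"
    using \<open>\<alpha>' > 1\<close> by (cases "\<eta> = 0") (auto simp: y_def powr_diff)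
  have y2: "\<bar>y\<bar> powr \<alpha> = \<bar>\<eta>\<bar> powr \<alpha>'"
    by (simp add: y_def powr_powr mult.commute prod)
  have "y * \<bar>\<eta>\<bar> - \<bar>y\<bar> powr \<alpha> / \<alpha> = \<bar>\<eta>\<bar> powr \<alpha>' * (1 - 1 / \<alpha>)"
    by (simp add: y1 y2 algebra_simps)
  also have "\<dots> = \<bar>\<eta>\<bar> powr \<alpha>' / \<alpha>'"
    using \<open>1 / \<alpha>' = 1 - 1 / \<alpha>\<close> by (metis times_divide_eq_right mult.right_neutral)
  finally have att: "\<bar>\<eta>\<bar> powr \<alpha>' / \<alpha>' = y * \<bar>\<eta>\<bar> - \<bar>y\<bar> powr \<alpha> / \<alpha>" ..
  have "y \<ge> 0" by (simp add: y_def)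
  show ?thesis
    unfolding young_conjugate_def
  proof (rule cSup_eq_maximum)
    show "\<bar>\<eta>\<bar> powr \<alpha>' / \<alpha>' \<in> (\<lambda>x. x * \<bar>\<eta>\<bar> - \<bar>x\<bar> powr \<alpha> / \<alpha>) ` {0..}"
      using att \<open>y \<ge> 0\<close> by blast
  next
    fix z assume "z \<in> (\<lambda>x. x * \<bar>\<eta>\<bar> - \<bar>x\<bar> powr \<alpha> / \<alpha>) ` {0..}"
    then obtain x where "x \<ge> 0" and z: "z = x * \<bar>\<eta>\<bar> - \<bar>x\<bar> powr \<alpha> / \<alpha>" by auto
    have "x * \<bar>\<eta>\<bar> \<le> x powr \<alpha> / \<alpha> + \<bar>\<eta>\<bar> powr \<alpha>' / \<alpha>'"
      using Youngs_inequality[of \<alpha> \<alpha>' x "\<bar>\<eta>\<bar>"] \<open>\<alpha> > 1\<close> \<open>\<alpha>' > 1\<close> conj \<open>x \<ge> 0\<close> by simp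
    then show "z \<le> \<bar>\<eta>\<bar> powr \<alpha>' / \<alpha>'" using z \<open>x \<ge> 0\<close> by simp
  qed
qed

end

theory Submission
  imports Defs
begin

text \<open>Young's inequality for the pair \<open>(r / l, l * \<eta>)\<close> leaves an integrable factor
  \<open>exp (- c * \<bar>r\<bar> powr \<alpha>)\<close>, which gives the upper bound. For the lower bound, take \<open>\<eta> \<ge> 0\<close> and let
  \<open>y\<close> be the point where \<open>y * (\<eta> / l) - p y\<close> is maximal. On \<open>{y..y + 1}\<close>, convexity of \<open>p\<close> with a suitable
  weight \<open>\<theta> < 1\<close> bounds \<open>p r\<close> by \<open>l * p y + K\<close> with \<open>K\<close> independent of \<open>\<eta>\<close>, so that the exponent
  is at least \<open>l * pstar (\<eta> / l) - K\<close> on an interval of length one.\<close>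

lemma conjugate_exponent_gt_1:
  fixes a b :: real
  assumes "a > 1" "1 / a + 1 / b = 1"
  shows "b > 1"
proof -
  have "0 < 1 - 1 / a" "1 - 1 / a < 1" using assms(1) by (auto simp: field_simps)
  then have "0 < 1 / b" "1 / b < 1" using assms(2) by linarith+
  then show ?thesis by (simp add: divide_less_eq split: if_splits)
qed

lemma integrable_exp_minus_abs:
  fixes c :: real
  assumes "c > 0"
  shows "integrable lborel (\<lambda>x. exp (- c * \<bar>x\<bar>))"
proof -
  have "(\<lambda>x. exp (- c * x)) absolutely_integrable_on {0..}"
    using assms by (intro nonnegative_absolutely_integrable_1 integrable_on_exp_minus_to_infinity) auto
  \<comment> \<open>Absolute integrability refers to the completed measure \<open>lebesgue\<close>;
    since the integrand is Borel measurable, it carries over to \<open>lborel\<close>.\<close>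
  then have "integrable lborel (\<lambda>x. indicator {0..} x *\<^sub>R exp (- c * x))" (is "integrable lborel ?f")
    unfolding set_integrable_def by (subst (asm) integrable_completion) auto
  \<comment> \<open>The one-sided exponential plus its reflection dominates the two-sided one; at
    the origin the two overlap, which does no harm to a bound.\<close>
  then have "integrable lborel (\<lambda>x. ?f x + ?f (- x))"
    using lborel_integrable_real_affine[of ?f "-1" 0] by simp
  then show ?thesis
    by (rule Bochner_Integration.integrable_bound) (auto split: split_indicator)
qed

lemma le_1_plus_powr:
  fixes x a :: real
  assumes "x \<ge> 0" "a \<ge> 1"
  shows "x \<le> 1 + x powr a"
proof (cases "x \<le> 1")
  case False
  then have "x powr 1 \<le> x powr a" using assms by (intro powr_mono) auto
  with False show ?thesis by simp
qed (simp add: add_increasing2)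

text \<open>Since \<open>\<bar>x\<bar>\<close> is at most \<open>1 + \<bar>x\<bar> powr a\<close>,
  the power can be traded for the first power at the cost of a factor \<open>exp c\<close>.\<close>

lemma integrable_exp_minus_powr:
  fixes c a :: real
  assumes "c > 0" "a \<ge> 1"
  shows "integrable lborel (\<lambda>x. exp (- c * \<bar>x\<bar> powr a))"
proof (rule Bochner_Integration.integrable_bound)
  show "integrable lborel (\<lambda>x. exp c * exp (- c * \<bar>x\<bar>))"
    by (intro integrable_mult_right integrable_exp_minus_abs assms)
  have "- c * \<bar>x\<bar> powr a \<le> c + - c * \<bar>x\<bar>" for x
    using mult_left_mono[OF le_1_plus_powr[of "\<bar>x\<bar>" a], of c] assms by (simp add: algebra_simps)
  then show "AE x in lborel. norm (exp (- c * \<bar>x\<bar> powr a)) \<le> norm (exp c * exp (- c * \<bar>x\<bar>))"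
    by (simp flip: exp_add)
qed simp

text \<open>Young's inequality uses up only the fraction \<open>(1 / l) powr a\<close> of
  \<open>\<bar>u\<bar> powr a / a\<close>. This fraction is below 1 because \<open>l > 1\<close>,
  and what is left over becomes the decay in \<open>u\<close>.\<close>

lemma exp_tilted_powr_bound:
  fixes a b t l x u :: real
  assumes "a > 1" "1 / a + 1 / b = 1" "t > 0" "l > 1"
  shows "exp (t * (u * x - \<bar>u\<bar> powr a / a))
    \<le> exp (t * (\<bar>l * x\<bar> powr b / b)) * exp (- (t * (1 - (1 / l) powr a) / a) * \<bar>u\<bar> powr a)"
proof -
  have "b > 1" by (rule conjugate_exponent_gt_1[OF assms(1,2)])
  have "u * x = (u / l) * (l * x)" using assms by simp
  also have "\<dots> \<le> \<bar>u / l\<bar> * \<bar>l * x\<bar>"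
    unfolding abs_mult[symmetric] by (rule abs_ge_self)
  also have "\<dots> \<le> \<bar>u / l\<bar> powr a / a + \<bar>l * x\<bar> powr b / b"
    by (rule Youngs_inequality) (use assms \<open>b > 1\<close> in auto)
  also have "\<bar>u / l\<bar> powr a = \<bar>u\<bar> powr a * (1 / l) powr a"
    using assms powr_mult[of "\<bar>u\<bar>" "1 / l" a] by (simp add: abs_divide)
  finally have "u * x - \<bar>u\<bar> powr a / a
      \<le> \<bar>l * x\<bar> powr b / b + - ((1 - (1 / l) powr a) / a) * \<bar>u\<bar> powr a"
    by (simp add: algebra_simps diff_divide_distrib)
  from mult_left_mono[OF this, of t] show ?thesis
    using assms by (simp add: algebra_simps flip: exp_add)
qed

lemma integrable_exp_tilted_powr:
  fixes a t x :: real
  assumes "a > 1" "t > 0"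
  shows "integrable lborel (\<lambda>u. exp (t * (u * x - \<bar>u\<bar> powr a / a)))"
proof (rule Bochner_Integration.integrable_bound)
  \<comment> \<open>The exponent conjugate to \<open>a\<close>. Any scale above 1 would serve in the
    bound below; 2 is taken.\<close>
  define b where "b = a / (a - 1)"
  have ab: "1 / a + 1 / b = 1"
    using assms by (simp add: b_def field_simps)
  have "(1 / 2) powr a < (1::real)" using powr_less_mono2[of a "1/2" 1] assms by simp
  then show "integrable lborel (\<lambda>u. exp (t * (\<bar>2 * x\<bar> powr b / b)) *
      exp (- (t * (1 - (1 / 2) powr a) / a) * \<bar>u\<bar> powr a))"
    using assms by (intro integrable_mult_right integrable_exp_minus_powr) auto
  show "AE u in lborel. norm (exp (t * (u * x - \<bar>u\<bar> powr a / a))) \<le>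
      norm (exp (t * (\<bar>2 * x\<bar> powr b / b)) * exp (- (t * (1 - (1 / 2) powr a) / a) * \<bar>u\<bar> powr a))"
    using exp_tilted_powr_bound[of a b t 2 _ x] assms ab by simp
qed simp

text \<open>Convexity of the power at \<open>x / \<theta>\<close> and
  \<open>y / (1 - \<theta>)\<close> with weights \<open>\<theta>\<close> and
  \<open>1 - \<theta>\<close>. Taking \<open>\<theta>\<close> near 1 brings the coefficient of
  \<open>x powr a\<close> as close to 1 as desired, and the price falls on the \<open>y\<close> term
  alone.\<close>

lemma powr_sum_le_weighted:
  fixes x y a \<theta> :: real
  assumes "a \<ge> 1" "0 < \<theta>" "\<theta> < 1" "x \<ge> 0" "y \<ge> 0"
  shows "(x + y) powr a \<le> \<theta> powr (1 - a) * x powr a + (1 - \<theta>) powr (1 - a) * y powr a"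
proof (cases "x = 0 \<or> y = 0")
  case True
  \<comment> \<open>With a vanishing summand it is enough that both coefficients are at least 1,
    which holds as \<open>1 - a\<close> is nonpositive and the weights lie below 1. Convexity is
    then applied only at positive points.\<close>
  have "s powr (1 - a) \<ge> 1" if "0 < s" "s < 1" for s :: real
    using powr_mono2'[of "1 - a" s 1] that assms by simp
  then have "z powr a \<le> s powr (1 - a) * z powr a" if "0 < s" "s < 1" for s z :: real
    using mult_right_mono[of 1 "s powr (1 - a)" "z powr a"] that by simp
  from this[of \<theta> x] this[of "1 - \<theta>" y] show ?thesis using True assms by auto
next
  case False
  have scale: "s * (z / s) powr a = s powr (1 - a) * z powr a" if "s > 0" "z \<ge> 0" for s z :: real
    using that by (simp add: powr_divide powr_diff)
  have "x + y = \<theta> * (x / \<theta>) + (1 - \<theta>) * (y / (1 - \<theta>))" using assms by simp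
  also have "\<dots> powr a \<le> \<theta> * (x / \<theta>) powr a + (1 - \<theta>) * (y / (1 - \<theta>)) powr a"
    using convex_onD[OF powr_convex[of a], of "1 - \<theta>" "x / \<theta>" "y / (1 - \<theta>)"] assms False by simp
  finally show ?thesis using assms scale by simp
qed

lemma exp_tilted_powr_lower:
  fixes a b t l :: real
  assumes "a > 1" and ab: "1 / a + 1 / b = 1" and "t > 0" "l > 1"
  obtains D where "D > 0"
    "\<And>x. D * exp (t * (\<bar>x / l\<bar> powr b / b)) \<le> (LINT u|lborel. exp (t * (u * x - \<bar>u\<bar> powr a / a)))"
proof -
  have "b > 1" by (rule conjugate_exponent_gt_1[OF assms(1,2)])
  have prod: "a * (b - 1) = b"
    using ab \<open>a > 1\<close> \<open>b > 1\<close> by (simp add: field_simps)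
  \<comment> \<open>The solution of \<open>\<theta> powr (1 - a) = l\<close>, so that the convexity
    estimate gives \<open>y powr a\<close> exactly the coefficient \<open>l\<close>.\<close>
  define \<theta> where "\<theta> = l powr (- 1 / (a - 1))"
  have "\<theta> < l powr 0" unfolding \<theta>_def using assms by (intro powr_less_mono) (auto simp: field_simps)
  then have \<theta>: "0 < \<theta>" "\<theta> < 1" using \<open>l > 1\<close> by (auto simp: \<theta>_def)
  have "(- 1 / (a - 1)) * (1 - a) = 1" using \<open>a > 1\<close> by (simp add: field_simps)
  then have \<theta>l: "\<theta> powr (1 - a) = l" unfolding \<theta>_def powr_powr using \<open>l > 1\<close> by simp
  \<comment> \<open>The cost of moving up to one unit away from the maximiser: the second term of
    the convexity estimate for the summand 1, divided by \<open>a\<close>. It does not depend on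
    \<open>x\<close>.\<close>
  define K where "K = (1 - \<theta>) powr (1 - a) / a"
  define F where "F = (\<lambda>x u. exp (t * (u * x - \<bar>u\<bar> powr a / a)))"
  have F_int: "integrable lborel (F x)" for x
    unfolding F_def by (rule integrable_exp_tilted_powr[OF assms(1,3)])
  have lower: "exp (- t * K) * exp (t * (\<bar>x / l\<bar> powr b / b)) \<le> (LINT u|lborel. F x u)"
    if "x \<ge> 0" for x
  proof -
    \<comment> \<open>The critical point of \<open>y * (x / l) - y powr a / a\<close>: it solves
      \<open>y powr (a - 1) = x / l\<close>, because \<open>(a - 1) * (b - 1) = 1\<close>.\<close>
    define y where "y = (x / l) powr (b - 1)"
    have "y \<ge> 0" by (simp add: y_def)
    have y1: "y * (x / l) = (x / l) powr b"
      using \<open>b > 1\<close> by (cases "x = 0") (use that assms in \<open>auto simp: y_def powr_diff\<close>)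
    have y2: "y powr a = (x / l) powr b"
      by (simp add: y_def powr_powr mult.commute prod)
    have "1 / b = 1 - 1 / a" using ab by simp
    then have opt: "y * (x / l) - y powr a / a = (x / l) powr b / b"
      unfolding y1 y2 by (metis times_divide_eq_right mult.right_neutral right_diff_distrib)
    let ?c = "exp (- t * K) * exp (t * (\<bar>x / l\<bar> powr b / b))"
    have point: "?c \<le> F x u" if u: "u \<in> {y..y + 1}" for u
    proof -
      have "\<bar>u\<bar> powr a \<le> (y + 1) powr a"
        using u \<open>y \<ge> 0\<close> \<open>a > 1\<close> by (intro powr_mono2) auto
      also have "\<dots> \<le> l * y powr a + (1 - \<theta>) powr (1 - a)"
        using powr_sum_le_weighted[of a \<theta> y 1] \<theta> \<theta>l \<open>y \<ge> 0\<close> \<open>a > 1\<close> by simp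
      finally have "\<bar>u\<bar> powr a / a \<le> (l * y powr a + (1 - \<theta>) powr (1 - a)) / a"
        using \<open>a > 1\<close> by (simp add: divide_right_mono)
      then have A: "\<bar>u\<bar> powr a / a \<le> l * (y powr a / a) + K"
        by (simp add: K_def add_divide_distrib)
      \<comment> \<open>Multiplying the optimal value by \<open>l\<close> only increases it and
        turns \<open>y * (x / l)\<close> into \<open>y * x\<close>, the linear term of the integrand
        at \<open>y\<close>. The coefficient \<open>l\<close> that this puts on
        \<open>y powr a / a\<close> is the one occurring in \<open>A\<close>. Passing from
        \<open>y * x\<close> to \<open>u * x\<close> then uses \<open>y \<le> u\<close> and
        \<open>x \<ge> 0\<close>.\<close>
      have "(x / l) powr b / b \<le> l * ((x / l) powr b / b)"
        using mult_right_mono[of 1 l "(x / l) powr b / b"] \<open>l > 1\<close> \<open>b > 1\<close> by simp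
      also have "\<dots> = y * x - l * (y powr a / a)"
        unfolding opt[symmetric] using \<open>l > 1\<close> by (simp add: algebra_simps)
      finally have "(x / l) powr b / b - K \<le> u * x - \<bar>u\<bar> powr a / a"
        using A mult_right_mono[of y u x] u \<open>x \<ge> 0\<close> by auto
      from mult_left_mono[OF this, of t] show ?thesis
        unfolding F_def using \<open>x \<ge> 0\<close> \<open>l > 1\<close> \<open>t > 0\<close> by (simp add: algebra_simps flip: exp_add)
    qed
    \<comment> \<open>The interval has length one, so the constant equals its integral there;
      outside it the integrand is positive.\<close>
    have "?c = (LINT u|lborel. indicator {y..y + 1} u * ?c)"
      by simp
    also have "\<dots> \<le> (LINT u|lborel. F x u)"
    proof (rule integral_mono[OF _ F_int])
      show "integrable lborel (\<lambda>u. indicator {y..y + 1} u * ?c)"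
        by (intro integrable_mult_left integrable_real_indicator) auto
      show "indicator {y..y + 1} u * ?c \<le> F x u" for u
        using point[of u] by (auto simp: F_def split: split_indicator)
    qed
    finally show ?thesis .
  qed
  \<comment> \<open>Reflecting \<open>u\<close> leaves the even term
    \<open>\<bar>u\<bar> powr a\<close> alone and flips the sign of \<open>x\<close>, which reduces
    negative \<open>x\<close> to the case already treated.\<close>
  have sym: "(LINT u|lborel. F (- x) u) = (LINT u|lborel. F x u)" for x
    using lborel_integral_real_affine[of "-1" "F x" 0] by (simp add: F_def)
  show thesis
  proof (rule that)
    show "exp (- t * K) * exp (t * (\<bar>x / l\<bar> powr b / b))
        \<le> (LINT u|lborel. exp (t * (u * x - \<bar>u\<bar> powr a / a)))" for x
      using lower[of x] lower[of "- x"] sym[of x] by (cases "x \<ge> 0") (auto simp: F_def)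
  qed simp
qed

lemma exp_tilted_powr_upper:
  fixes a b t l :: real
  assumes "a > 1" "1 / a + 1 / b = 1" "t > 0" "l > 1"
  obtains C where "C > 0"
    "\<And>x. (LINT u|lborel. exp (t * (u * x - \<bar>u\<bar> powr a / a))) \<le> C * exp (t * (\<bar>l * x\<bar> powr b / b))"
proof -
  define c where "c = t * (1 - (1 / l) powr a) / a"
  \<comment> \<open>The integral of the leftover decay factor, which is independent of
    \<open>x\<close> and hence yields a uniform constant.\<close>
  define I where "I = (LINT u|lborel. exp (- c * \<bar>u\<bar> powr a))"
  have "(1 / l) powr a < 1" using powr_less_mono2[of a "1 / l" 1] assms by simp
  then have "c > 0" using assms by (simp add: c_def)
  then have int: "integrable lborel (\<lambda>u. exp (- c * \<bar>u\<bar> powr a))"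
    using assms by (intro integrable_exp_minus_powr) auto
  have "I \<ge> 0" unfolding I_def by (rule integral_nonneg_AE) simp
  show thesis
  proof (rule that)
    fix x
    have "(LINT u|lborel. exp (t * (u * x - \<bar>u\<bar> powr a / a)))
        \<le> (LINT u|lborel. exp (t * (\<bar>l * x\<bar> powr b / b)) * exp (- c * \<bar>u\<bar> powr a))"
      using exp_tilted_powr_bound[OF assms] unfolding c_def[symmetric]
      by (intro integral_mono integrable_mult_right integrable_exp_tilted_powr int) (use assms in auto)
    also have "\<dots> = I * exp (t * (\<bar>l * x\<bar> powr b / b))"
      by (simp add: I_def)
    \<comment> \<open>Adding 1 makes the constant positive from \<open>I \<ge> 0\<close> alone,
      without a proof that the integral is strictly positive.\<close>
    also have "\<dots> \<le> (I + 1) * exp (t * (\<bar>l * x\<bar> powr b / b))"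
      by (intro mult_right_mono) auto
    finally show "(LINT u|lborel. exp (t * (u * x - \<bar>u\<bar> powr a / a)))
        \<le> (I + 1) * exp (t * (\<bar>l * x\<bar> powr b / b))" .
  qed (use \<open>I \<ge> 0\<close> in simp)
qed

theorem mainTheorem5:
  fixes \<alpha> \<alpha>' \<tau> :: real and p pstar :: "real \<Rightarrow> real"
  assumes "\<alpha> > 1"
    and "1 / \<alpha> + 1 / \<alpha>' = 1"
    and "\<And>r. p r = \<bar>r\<bar> powr \<alpha> / \<alpha>"
    and "\<And>\<eta>. pstar \<eta> = \<bar>\<eta>\<bar> powr \<alpha>' / \<alpha>'"
    and "\<tau> > 0"
  shows "\<forall>l>1. \<exists>C D C\<^sub>1 D\<^sub>1 :: real. C > 0 \<and> D > 0 \<and> C\<^sub>1 > 0 \<and> D\<^sub>1 > 0 \<and>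
    (\<forall>\<eta>. integrable lborel (\<lambda>r. exp (2 * \<tau> * (r * \<eta> - p r))) \<and>
         D * exp (2 * \<tau> * pstar (\<eta> / l)) \<le> (LINT r|lborel. exp (2 * \<tau> * (r * \<eta> - p r))) \<and>
         (LINT r|lborel. exp (2 * \<tau> * (r * \<eta> - p r))) \<le> C * exp (2 * \<tau> * pstar (l * \<eta>))) \<and>
    (\<forall>r. integrable lborel (\<lambda>\<eta>. exp (2 * \<tau> * (r * \<eta> - pstar \<eta>))) \<and>
         D\<^sub>1 * exp (2 * \<tau> * p (r / l)) \<le> (LINT \<eta>|lborel. exp (2 * \<tau> * (r * \<eta> - pstar \<eta>))) \<and>
         (LINT \<eta>|lborel. exp (2 * \<tau> * (r * \<eta> - pstar \<eta>))) \<le> C\<^sub>1 * exp (2 * \<tau> * p (l * r)))"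
proof (intro allI impI)
  fix l :: real
  assume "l > 1"
  have t: "2 * \<tau> > 0" using assms(5) by simp
  have \<alpha>': "\<alpha>' > 1" by (rule conjugate_exponent_gt_1[OF assms(1,2)])
  \<comment> \<open>Conjugacy is symmetric in the two exponents, so the same two lemmas with the
    exponents exchanged give the second pair of bounds.\<close>
  have conj: "1 / \<alpha>' + 1 / \<alpha> = 1" using assms(2) by simp
  note fwd = assms(1,2) t \<open>l > 1\<close> and bwd = \<alpha>' conj t \<open>l > 1\<close>
  obtain C where C: "C > 0" "\<And>x. (LINT u|lborel. exp (2 * \<tau> * (u * x - \<bar>u\<bar> powr \<alpha> / \<alpha>)))
      \<le> C * exp (2 * \<tau> * (\<bar>l * x\<bar> powr \<alpha>' / \<alpha>'))"
    using exp_tilted_powr_upper[OF fwd] by blast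
  obtain D where D: "D > 0" "\<And>x. D * exp (2 * \<tau> * (\<bar>x / l\<bar> powr \<alpha>' / \<alpha>'))
      \<le> (LINT u|lborel. exp (2 * \<tau> * (u * x - \<bar>u\<bar> powr \<alpha> / \<alpha>)))"
    using exp_tilted_powr_lower[OF fwd] by blast
  obtain C\<^sub>1 where C\<^sub>1: "C\<^sub>1 > 0" "\<And>x. (LINT u|lborel. exp (2 * \<tau> * (u * x - \<bar>u\<bar> powr \<alpha>' / \<alpha>')))
      \<le> C\<^sub>1 * exp (2 * \<tau> * (\<bar>l * x\<bar> powr \<alpha> / \<alpha>))"
    using exp_tilted_powr_upper[OF bwd] by blast
  obtain D\<^sub>1 where D\<^sub>1: "D\<^sub>1 > 0" "\<And>x. D\<^sub>1 * exp (2 * \<tau> * (\<bar>x / l\<bar> powr \<alpha> / \<alpha>))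
      \<le> (LINT u|lborel. exp (2 * \<tau> * (u * x - \<bar>u\<bar> powr \<alpha>' / \<alpha>')))"
    using exp_tilted_powr_lower[OF bwd] by blast
  note int = integrable_exp_tilted_powr[OF assms(1) t] integrable_exp_tilted_powr[OF \<alpha>' t]
  have "\<forall>\<eta>. integrable lborel (\<lambda>r. exp (2 * \<tau> * (r * \<eta> - p r))) \<and>
      D * exp (2 * \<tau> * pstar (\<eta> / l)) \<le> (LINT r|lborel. exp (2 * \<tau> * (r * \<eta> - p r))) \<and>
      (LINT r|lborel. exp (2 * \<tau> * (r * \<eta> - p r))) \<le> C * exp (2 * \<tau> * pstar (l * \<eta>))"
    unfolding assms(3,4) using int(1) C(2) D(2) by blast
  moreover have "\<forall>r. integrable lborel (\<lambda>\<eta>. exp (2 * \<tau> * (r * \<eta> - pstar \<eta>))) \<and>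
      D\<^sub>1 * exp (2 * \<tau> * p (r / l)) \<le> (LINT \<eta>|lborel. exp (2 * \<tau> * (r * \<eta> - pstar \<eta>))) \<and>
      (LINT \<eta>|lborel. exp (2 * \<tau> * (r * \<eta> - pstar \<eta>))) \<le> C\<^sub>1 * exp (2 * \<tau> * p (l * r))"
  proof
    fix r
    \<comment> \<open>Here the integration variable is the second factor of the product, while the
      lemmas have it first.\<close>
    have "(\<lambda>\<eta>. exp (2 * \<tau> * (r * \<eta> - pstar \<eta>))) = (\<lambda>u. exp (2 * \<tau> * (u * r - \<bar>u\<bar> powr \<alpha>' / \<alpha>')))"
      by (simp add: assms(4) mult.commute)
    then show "integrable lborel (\<lambda>\<eta>. exp (2 * \<tau> * (r * \<eta> - pstar \<eta>))) \<and>
        D\<^sub>1 * exp (2 * \<tau> * p (r / l)) \<le> (LINT \<eta>|lborel. exp (2 * \<tau> * (r * \<eta> - pstar \<eta>))) \<and>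
        (LINT \<eta>|lborel. exp (2 * \<tau> * (r * \<eta> - pstar \<eta>))) \<le> C\<^sub>1 * exp (2 * \<tau> * p (l * r))"
      using int(2)[of r] C\<^sub>1(2)[of r] D\<^sub>1(2)[of r] by (simp add: assms(3))
  qed
  ultimately show "\<exists>C D C\<^sub>1 D\<^sub>1 :: real. C > 0 \<and> D > 0 \<and> C\<^sub>1 > 0 \<and> D\<^sub>1 > 0 \<and>
    (\<forall>\<eta>. integrable lborel (\<lambda>r. exp (2 * \<tau> * (r * \<eta> - p r))) \<and>
         D * exp (2 * \<tau> * pstar (\<eta> / l)) \<le> (LINT r|lborel. exp (2 * \<tau> * (r * \<eta> - p r))) \<and>
         (LINT r|lborel. exp (2 * \<tau> * (r * \<eta> - p r))) \<le> C * exp (2 * \<tau> * pstar (l * \<eta>))) \<and>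
    (\<forall>r. integrable lborel (\<lambda>\<eta>. exp (2 * \<tau> * (r * \<eta> - pstar \<eta>))) \<and>
         D\<^sub>1 * exp (2 * \<tau> * p (r / l)) \<le> (LINT \<eta>|lborel. exp (2 * \<tau> * (r * \<eta> - pstar \<eta>))) \<and>
         (LINT \<eta>|lborel. exp (2 * \<tau> * (r * \<eta> - pstar \<eta>))) \<le> C\<^sub>1 * exp (2 * \<tau> * p (l * r)))"
    using C(1) D(1) C\<^sub>1(1) D\<^sub>1(1) by blast
qed

end
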